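(* Let $n\ge1$ and let $\beta^L,\beta^R$ be two pairings of $\{1,\dots,n\}$ such that, viewing them as involutions, $\{1,\beta^R(1),\beta^L(\beta^R(1)),\beta^R(\beta^L(\beta^R(1))),\dots\}=\{1,\dots,n\}$. Then $(\mathcal A^M_{SFT},d^M)$ is a differential graded algebra; in other words, $d^M=\{h^M,\cdot\}+\delta^M_{str}$ satisfies $(d^M)^2=0$.
   Context: A pairing of $\{1,\dots,n\}$ is a partition into two-element sets, identified with a fixed-point-free involution. $\mathcal A^M_{SFT}$ is the free commutative (polynomial) unital algebra over $\mathbb Z_2$ on generators $\alpha^L_{ij},\alpha^R_{ij}$ for all $1\le i<j\le n$, $\beta^L_{ij}$ for $i<j$ with $\{i,j\}\in\beta^L$, and $\beta^R_{ij}$ for $i<j$ with $\{i,j\}\in\beta^R$ (write $\beta^x_{ji}=\beta^x_{ij}$). It is graded, using a function $\mu:\{1,\dots,n\}\to\mathbb Z$, by $|\alpha^L_{ij}|=\mu(i)-\mu(j)-1$, $|\alpha^R_{ij}|=\mu(j)-\mu(i)-1$, $|\beta^L_{ij}|=|\beta^R_{ij}|=-1$. Bracket: the unique symmetric bilinear map $\{\cdot,\cdot\}$ on $\mathcal A^M_{SFT}$ with $\{x,yz\}=\{x,y\}z+y\{x,z\}$ and, for $x\in\{L,R\}$: $\{\alpha^x_{ij},\alpha^x_{kl}\}=\alpha^x_{il}$ if $j=k$, $=\alpha^x_{kj}$ if $i=l$, $=0$ otherwise; $\{\alpha^x_{ij},\beta^x_{kl}\}=\alpha^x_{ij}$ if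 $|\{i,j\}\cap\{k,l\}|=1$ and $0$ otherwise; $\{\beta^x_{ij},\beta^x_{kl}\}=0$; and $\{g,g'\}=0$ whenever $g$ is a generator with superscript $L$ and $g'$ one with superscript $R$. Hamiltonian: $h^M=\sum_{1\le i<j\le n}\alpha^L_{ij}\alpha^R_{ij}$. For $i\in\{1,\dots,n\}$, follow the sequence $1,\beta^R(1),\beta^L(\beta^R(1)),\dots$ (applying $\beta^R$ and $\beta^L$ alternately, starting with $\beta^R$) until $i$ first occurs; $\gamma_i$ is the sum of the corresponding generators $\beta^R_{1,\beta^R(1)}+\beta^L_{\beta^R(1),\beta^L(\beta^R(1))}+\cdots$ of the steps taken ($\gamma_1=0$). String differential: $\delta^M_{str}$ is the derivation with $\delta^M_{str}(\alpha^x_{ij})=(\gamma_i+\gamma_j)\alpha^x_{ij}+\sum_{i<k<j}\alpha^x_{ik}\alpha^x_{kj}$ and $\delta^M_{str}(\beta^x_{ij})=(\beta^x_{ij})^2$ for $x\in\{L,R\}$. *)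

theory Defs
  imports "HOL-Library.Poly_Mapping" "HOL-Library.Z2" "HOL-Library.Disjoint_Sets"
begin

section \<open>Polynomials and derivations\<close>

text \<open>
  A polynomial is a finitely supported function from monomials to coefficients, a monomial
  a finitely supported exponent function on the variables.
\<close>

type_synonym ('v, 'k) mpol = "('v \<Rightarrow>\<^sub>0 nat) \<Rightarrow>\<^sub>0 'k"

definition var :: "'v \<Rightarrow> ('v, 'k::comm_ring_1) mpol" where
  "var g = Poly_Mapping.single (Poly_Mapping.single g 1) 1"

definition polys :: "'v set \<Rightarrow> ('v, 'k::comm_ring_1) mpol set" where
  "polys S = {p. \<forall>m \<in> Poly_Mapping.keys p. Poly_Mapping.keys m \<subseteq> S}"

definition scal :: "'k \<Rightarrow> ('v, 'k::comm_ring_1) mpol" where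
  "scal c = Poly_Mapping.single 0 c"

text \<open>
  The derivation with prescribed values \<open>f\<close> on the variables, that is
  \<open>p \<mapsto> (\<Sum>g. \<partial>p/\<partial>g * f g)\<close>; the lemmas below show that it is the only linear map which satisfies
  the Leibniz rule and extends \<open>f\<close>.
\<close>

definition mon_deriv ::
  "('v \<Rightarrow> ('v, 'k) mpol) \<Rightarrow> ('v \<Rightarrow>\<^sub>0 nat) \<Rightarrow> ('v, 'k::comm_ring_1) mpol" where
  "mon_deriv f m = (\<Sum>g \<in> Poly_Mapping.keys m. of_nat (Poly_Mapping.lookup m g)
      * Poly_Mapping.single (m - Poly_Mapping.single g 1) 1 * f g)"

definition deriv_ext ::
  "('v \<Rightarrow> ('v, 'k) mpol) \<Rightarrow> ('v, 'k) mpol \<Rightarrow> ('v, 'k::comm_ring_1) mpol" where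
  "deriv_ext f p =
     (\<Sum>m \<in> Poly_Mapping.keys p. scal (Poly_Mapping.lookup p m) * mon_deriv f m)"

lemma deriv_ext_superset:
  assumes "finite K" "Poly_Mapping.keys p \<subseteq> K"
  shows "deriv_ext f p = (\<Sum>m \<in> K. scal (Poly_Mapping.lookup p m) * mon_deriv f m)"
  unfolding deriv_ext_def
  by (rule sum.mono_neutral_left) (use assms in \<open>auto simp: in_keys_iff scal_def\<close>)

lemma deriv_ext_zero [simp]: "deriv_ext f 0 = 0"
  by (simp add: deriv_ext_def)

lemma deriv_ext_add: "deriv_ext f (p + q) = deriv_ext f p + deriv_ext f q"
proof -
  let ?K = "Poly_Mapping.keys p \<union> Poly_Mapping.keys q"
  have "deriv_ext f (p + q) =
      (\<Sum>m \<in> ?K. scal (Poly_Mapping.lookup (p + q) m) * mon_deriv f m)"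
    by (rule deriv_ext_superset) (simp_all add: keys_add)
  also have "\<dots> = (\<Sum>m \<in> ?K. scal (Poly_Mapping.lookup p m) * mon_deriv f m)
      + (\<Sum>m \<in> ?K. scal (Poly_Mapping.lookup q m) * mon_deriv f m)"
    by (simp add: lookup_add scal_def single_add distrib_right sum.distrib)
  also have "\<dots> = deriv_ext f p + deriv_ext f q"
    using deriv_ext_superset[of ?K p f] deriv_ext_superset[of ?K q f] by simp
  finally show ?thesis .
qed

lemma deriv_ext_single: "deriv_ext f (Poly_Mapping.single m c) = scal c * mon_deriv f m"
  by (simp add: deriv_ext_def scal_def)

lemma mon_deriv_superset:
  assumes "finite K" "Poly_Mapping.keys m \<subseteq> K"
  shows "mon_deriv f m = (\<Sum>g \<in> K. of_nat (Poly_Mapping.lookup m g)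
      * Poly_Mapping.single (m - Poly_Mapping.single g 1) 1 * f g)"
  unfolding mon_deriv_def
  by (rule sum.mono_neutral_left) (use assms in \<open>auto simp: in_keys_iff\<close>)

lemma minus_single_add:
  fixes a b :: "'v \<Rightarrow>\<^sub>0 nat"
  assumes "Poly_Mapping.lookup a g \<noteq> 0"
  shows "a + b - Poly_Mapping.single g 1 = (a - Poly_Mapping.single g 1) + b"
  by (rule poly_mapping_eqI) (use assms in \<open>auto simp: lookup_add lookup_minus lookup_single when_def\<close>)

lemma mon_deriv_add:
  "mon_deriv f (a + b) = mon_deriv f a * Poly_Mapping.single b 1
      + Poly_Mapping.single a 1 * mon_deriv f b"
proof -
  let ?K = "Poly_Mapping.keys a \<union> Poly_Mapping.keys b"
  let ?T = "\<lambda>m g. of_nat (Poly_Mapping.lookup m g)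
      * Poly_Mapping.single (m - Poly_Mapping.single g 1) 1 * f g"
  have *: "?T (a + b) g = ?T a g * Poly_Mapping.single b 1 + Poly_Mapping.single a 1 * ?T b g" for g
  proof -
    have A: "of_nat (Poly_Mapping.lookup a g) * Poly_Mapping.single (a + b - Poly_Mapping.single g 1) (1::'b)
        = of_nat (Poly_Mapping.lookup a g) * (Poly_Mapping.single (a - Poly_Mapping.single g 1) 1
            * Poly_Mapping.single b 1)"
      by (cases "Poly_Mapping.lookup a g = 0") (simp_all only: minus_single_add mult_single of_nat_0 mult_zero_left mult_1 not_False_eq_True)
    have B: "of_nat (Poly_Mapping.lookup b g) * Poly_Mapping.single (a + b - Poly_Mapping.single g 1) (1::'b)
        = of_nat (Poly_Mapping.lookup b g) * (Poly_Mapping.single (b - Poly_Mapping.single g 1) 1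
            * Poly_Mapping.single a 1)"
      by (cases "Poly_Mapping.lookup b g = 0")
        (simp_all only: minus_single_add mult_single add.commute[of a b] of_nat_0 mult_zero_left mult_1
          not_False_eq_True)
    have "?T (a + b) g = (of_nat (Poly_Mapping.lookup a g) * Poly_Mapping.single (a + b - Poly_Mapping.single g 1) 1
        + of_nat (Poly_Mapping.lookup b g) * Poly_Mapping.single (a + b - Poly_Mapping.single g 1) 1) * f g"
      by (simp add: lookup_add distrib_right)
    also have "\<dots> = ?T a g * Poly_Mapping.single b 1 + Poly_Mapping.single a 1 * ?T b g"
      unfolding A B by (simp add: algebra_simps)
    finally show ?thesis .
  qed
  have "mon_deriv f (a + b) = (\<Sum>g\<in>?K. ?T (a + b) g)"
    by (rule mon_deriv_superset) (simp_all add: keys_add)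
  also have "\<dots> = (\<Sum>g\<in>?K. ?T a g) * Poly_Mapping.single b 1
      + Poly_Mapping.single a 1 * (\<Sum>g\<in>?K. ?T b g)"
    unfolding * by (simp add: sum.distrib sum_distrib_left sum_distrib_right)
  also have "\<dots> = mon_deriv f a * Poly_Mapping.single b 1
      + Poly_Mapping.single a 1 * mon_deriv f b"
    using mon_deriv_superset[of ?K a f] mon_deriv_superset[of ?K b f] by simp
  finally show ?thesis .
qed

lemma mpol_induct [case_names zero single add]:
  assumes "P 0" and "\<And>m c. P (Poly_Mapping.single m c)"
    and "\<And>p q. P p \<Longrightarrow> P q \<Longrightarrow> P (p + q)"
  shows "P (p :: ('v, 'k::comm_ring_1) mpol)"
proof -
  have p: "p = (\<Sum>m \<in> Poly_Mapping.keys p. Poly_Mapping.single m (Poly_Mapping.lookup p m))"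
    by (rule poly_mapping_eqI) (auto simp: lookup_sum lookup_single when_def in_keys_iff sum.delta)
  have "P (\<Sum>m \<in> K. Poly_Mapping.single m (Poly_Mapping.lookup p m))" if "finite K" for K
    using that by (induction K rule: finite_induct) (auto intro: assms)
  then show ?thesis by (subst p) simp
qed

lemma deriv_ext_mult: "deriv_ext f (p * q) = deriv_ext f p * q + p * deriv_ext f q"
proof (induction p rule: mpol_induct)
  case (single m c)
  show ?case
  proof (induction q rule: mpol_induct)
    case (single m' c')
    have s: "Poly_Mapping.single k d = scal d * Poly_Mapping.single k 1" for k and d :: 'b
      by (simp add: scal_def mult_single)
    have t: "scal (c * c') = scal c * (scal c' :: ('a, 'b) mpol)"
      by (simp add: scal_def mult_single)
    show ?case
      unfolding mult_single deriv_ext_single mon_deriv_add t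
      by (subst (3) s, subst (4) s) (simp add: algebra_simps)
  qed (simp_all add: deriv_ext_add algebra_simps)
qed (simp_all add: deriv_ext_add algebra_simps)

lemma deriv_ext_var: "deriv_ext f (var g) = f g"
  by (simp add: var_def deriv_ext_single mon_deriv_def scal_def)

lemma deriv_ext_const [simp]: "deriv_ext f (scal c) = 0"
  by (simp add: scal_def deriv_ext_single mon_deriv_def)

lemma deriv_ext_scal: "deriv_ext f (scal c * p) = scal c * deriv_ext f p"
  by (simp add: deriv_ext_mult)

text \<open>Induction over the polynomials in the variables \<open>S\<close>.\<close>

lemma polys_induct [consumes 1, case_names zero one var mult scal add]:
  assumes p: "p \<in> polys S"
    and zero: "P 0" and one: "P 1"
    and var: "\<And>g. g \<in> S \<Longrightarrow> P (var g)"
    and mult: "\<And>p q. p \<in> polys S \<Longrightarrow> q \<in> polys S \<Longrightarrow> P p \<Longrightarrow> P q \<Longrightarrow> P (p * q)"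
    and scal: "\<And>c p. p \<in> polys S \<Longrightarrow> P p \<Longrightarrow> P (scal c * p)"
    and add: "\<And>p q. p \<in> polys S \<Longrightarrow> q \<in> polys S \<Longrightarrow> P p \<Longrightarrow> P q \<Longrightarrow> P (p + q)"
  shows "P (p :: ('v, 'k::comm_ring_1) mpol)"
proof -
  have mon: "P (Poly_Mapping.single m 1)" if "Poly_Mapping.keys m \<subseteq> S" for m :: "'v \<Rightarrow>\<^sub>0 nat"
    using that
  proof (induction "\<Sum>g\<in>Poly_Mapping.keys m. Poly_Mapping.lookup m g" arbitrary: m rule: less_induct)
    case less
    show ?case
    proof (cases "m = 0")
      case True
      then show ?thesis using one by simp
    next
      case False
      then obtain g where g: "g \<in> Poly_Mapping.keys m"
        by (metis equals0I keys_eq_empty)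
      define m' where "m' = m - Poly_Mapping.single g 1"
      have m: "m = Poly_Mapping.single g 1 + m'"
        unfolding m'_def
        by (rule poly_mapping_eqI)
          (use g in \<open>auto simp: lookup_add lookup_minus lookup_single when_def in_keys_iff\<close>)
      have k: "Poly_Mapping.keys m' \<subseteq> Poly_Mapping.keys m"
        by (auto simp: m'_def in_keys_iff lookup_minus)
      have "(\<Sum>g\<in>Poly_Mapping.keys m'. Poly_Mapping.lookup m' g)
          = (\<Sum>g\<in>Poly_Mapping.keys m. Poly_Mapping.lookup m' g)"
        by (rule sum.mono_neutral_left) (use k in \<open>auto simp: in_keys_iff\<close>)
      also have "\<dots> < (\<Sum>g\<in>Poly_Mapping.keys m. Poly_Mapping.lookup m g)"
        by (rule sum_strict_mono_ex1)
          (use g in \<open>auto simp: m'_def lookup_minus lookup_single in_keys_iff intro!: bexI[of _ g]\<close>)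
      finally have "P (Poly_Mapping.single m' 1)"
        using less k by blast
      moreover have "Poly_Mapping.single m' 1 \<in> polys S" "(var g :: ('v, 'k) mpol) \<in> polys S" "P (var g)"
        using k g less.prems var by (auto simp: polys_def var_def)
      ultimately have "P (var g * Poly_Mapping.single m' 1)"
        using mult by blast
      then show ?thesis
        by (subst m) (simp add: var_def mult_single)
    qed
  qed
  have pe: "p = (\<Sum>m \<in> Poly_Mapping.keys p. Poly_Mapping.single m (Poly_Mapping.lookup p m))"
    by (rule poly_mapping_eqI) (auto simp: lookup_sum lookup_single when_def in_keys_iff sum.delta)
  have one_term: "P (Poly_Mapping.single m c) \<and> Poly_Mapping.single m c \<in> polys S"
    if "Poly_Mapping.keys m \<subseteq> S" for m and c :: 'k
  proof -
    have "Poly_Mapping.single m c = scal c * Poly_Mapping.single m 1"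
      by (simp add: scal_def mult_single)
    moreover have "Poly_Mapping.single m (d :: 'k) \<in> polys S" for d
      using that by (simp add: polys_def)
    ultimately show ?thesis using scal mon[OF that] by metis
  qed
  have "P (\<Sum>m \<in> K. Poly_Mapping.single m (Poly_Mapping.lookup p m))
      \<and> (\<Sum>m \<in> K. Poly_Mapping.single m (Poly_Mapping.lookup p m)) \<in> polys S"
    if "finite K" "K \<subseteq> Poly_Mapping.keys p" for K
    using that
  proof (induction K rule: finite_induct)
    case empty
    then show ?case using zero by (simp add: polys_def)
  next
    case (insert m K)
    have m: "Poly_Mapping.keys m \<subseteq> S" using insert.prems p by (auto simp: polys_def)
    have "a + b \<in> polys S" if "a \<in> polys S" "b \<in> polys S" for a b :: "('v, 'k) mpol"
      using that keys_add[of a b] by (fastforce simp: polys_def)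
    then show ?case
      using insert one_term[OF m] add by auto
  qed
  from this[of "Poly_Mapping.keys p"] show ?thesis by (subst pe) simp
qed

lemma deriv_ext_unique:
  fixes D :: "('v, 'k::comm_ring_1) mpol \<Rightarrow> ('v, 'k) mpol"
  assumes add: "\<And>p q. p \<in> polys S \<Longrightarrow> q \<in> polys S \<Longrightarrow> D (p + q) = D p + D q"
    and scal: "\<And>c p. p \<in> polys S \<Longrightarrow> D (scal c * p) = scal c * D p"
    and mult: "\<And>p q. p \<in> polys S \<Longrightarrow> q \<in> polys S \<Longrightarrow> D (p * q) = D p * q + p * D q"
    and var: "\<And>g. g \<in> S \<Longrightarrow> D (var g) = f g"
    and p: "p \<in> polys S"
  shows "D p = deriv_ext f p"
  using p
proof (induction p rule: polys_induct)
  case zero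
  have "D (0 + 0) = D 0 + D 0" by (rule add) (simp_all add: polys_def)
  then show ?case by simp
next
  case one
  have "D (1 * 1) = D 1 * 1 + 1 * D 1" by (rule mult) (simp_all add: polys_def)
  moreover have "deriv_ext f 1 = deriv_ext f 1 + deriv_ext f 1"
    using deriv_ext_mult[of f 1 1] by simp
  ultimately show ?case by simp
qed (simp_all add: add scal mult var deriv_ext_add deriv_ext_scal deriv_ext_mult deriv_ext_var)


section \<open>Differential graded algebras over the field with two elements\<close>

text \<open>
  The algebra has carrier \<open>A\<close> inside a commutative ring of characteristic 2, and \<open>G k\<close> is its
  part of degree \<open>k\<close>. Over this field, linear means additive and the Leibniz rule has no signs.
  The differential lowers the degree by one.
\<close>

definition subalgebra2 :: "'a::comm_ring_1 set \<Rightarrow> bool" where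
  "subalgebra2 A \<longleftrightarrow> (1::'a) + 1 = 0 \<and> 0 \<in> A \<and> 1 \<in> A
     \<and> (\<forall>x\<in>A. \<forall>y\<in>A. x + y \<in> A \<and> x * y \<in> A)"

definition graded_by :: "'a::comm_ring_1 set \<Rightarrow> (int \<Rightarrow> 'a set) \<Rightarrow> bool" where
  "graded_by A G \<longleftrightarrow>
     (\<forall>k. G k \<subseteq> A \<and> 0 \<in> G k \<and> (\<forall>x\<in>G k. \<forall>y\<in>G k. x + y \<in> G k))
     \<and> (\<forall>x\<in>A. \<exists>!c. finite {k. c k \<noteq> 0} \<and> (\<forall>k. c k \<in> G k) \<and> x = (\<Sum>k | c k \<noteq> 0. c k))
     \<and> 1 \<in> G 0 \<and> (\<forall>k l. \<forall>x\<in>G k. \<forall>y\<in>G l. x * y \<in> G (k + l))"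

definition dga2 :: "'a::comm_ring_1 set \<Rightarrow> (int \<Rightarrow> 'a set) \<Rightarrow> ('a \<Rightarrow> 'a) \<Rightarrow> bool" where
  "dga2 A G d \<longleftrightarrow> subalgebra2 A \<and> graded_by A G
     \<and> (\<forall>x\<in>A. d x \<in> A)
     \<and> (\<forall>x\<in>A. \<forall>y\<in>A. d (x + y) = d x + d y)
     \<and> (\<forall>x\<in>A. \<forall>y\<in>A. d (x * y) = d x * y + x * d y)
     \<and> (\<forall>k. \<forall>x\<in>G k. d x \<in> G (k - 1))
     \<and> (\<forall>x\<in>A. d (d x) = 0)"


section \<open>Pairings\<close>

definition pairing :: "nat \<Rightarrow> nat set set \<Rightarrow> bool" where
  "pairing n P \<longleftrightarrow> partition_on {1..n} P \<and> (\<forall>B\<in>P. card B = 2)"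

definition partner :: "nat set set \<Rightarrow> nat \<Rightarrow> nat" where
  "partner P i = (THE j. {i, j} \<in> P)"

lemma partner:
  assumes P: "pairing n P" and i: "i \<in> {1..n}"
  shows "{i, partner P i} \<in> P" "partner P i \<noteq> i" "partner P i \<in> {1..n}"
    "partner P (partner P i) = i"
proof -
  have ex1: "\<exists>!j. {k, j} \<in> P" if k: "k \<in> {1..n}" for k
  proof -
    have "\<Union>P = {1..n}" and dis: "disjoint P"
      using P by (auto simp: pairing_def partition_on_def)
    then obtain B where B: "B \<in> P" "k \<in> B" using k by blast
    then obtain j where j: "B = {k, j}"
      using P unfolding pairing_def card_2_iff by (metis doubleton_eq_iff insertE singletonD)
    have "l = j" if "{k, l} \<in> P" for l
    proof -
      have "{k, l} = {k, j}"
        using disjointD[OF dis that, of "{k, j}"] B j by blast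
      then show ?thesis by (auto simp: doubleton_eq_iff)
    qed
    then show ?thesis using B j by blast
  qed
  show 1: "{i, partner P i} \<in> P"
    unfolding partner_def by (rule theI') (rule ex1[OF i])
  show "partner P i \<noteq> i"
    using P 1 by (auto simp: pairing_def)
  show 2: "partner P i \<in> {1..n}"
    using P 1 by (auto simp: pairing_def partition_on_def)
  show "partner P (partner P i) = i"
    unfolding partner_def[of P "partner P i"]
    by (rule the1_equality[OF ex1[OF 2]]) (use 1 in \<open>simp add: insert_commute\<close>)
qed


section \<open>The algebra, the bracket and the string differential\<close>

datatype side = L | R

text \<open>
  The generator \<open>\<beta>\<^sup>x\<^bsub>ij\<^esub>\<close> is indexed by the unordered pair \<open>{i, j}\<close>, which builds in the
  convention \<open>\<beta>\<^sup>x\<^bsub>ji\<^esub> = \<beta>\<^sup>x\<^bsub>ij\<^esub>\<close>.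
\<close>

datatype gen = Alpha side nat nat | Beta side "nat set"

type_synonym alg = "(gen, bit) mpol"

definition gens :: "nat \<Rightarrow> (side \<Rightarrow> nat set set) \<Rightarrow> gen set" where
  "gens n \<beta> = {Alpha x i j | x i j. 1 \<le> i \<and> i < j \<and> j \<le> n} \<union> {Beta x B | x B. B \<in> \<beta> x}"

definition A_SFT :: "nat \<Rightarrow> (side \<Rightarrow> nat set set) \<Rightarrow> alg set" where
  "A_SFT n \<beta> = polys (gens n \<beta>)"

fun gen_deg :: "(nat \<Rightarrow> int) \<Rightarrow> gen \<Rightarrow> int" where
  "gen_deg \<mu> (Alpha L i j) = \<mu> i - \<mu> j - 1"
| "gen_deg \<mu> (Alpha R i j) = \<mu> j - \<mu> i - 1"
| "gen_deg \<mu> (Beta x B) = -1"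

definition mon_deg :: "(nat \<Rightarrow> int) \<Rightarrow> (gen \<Rightarrow>\<^sub>0 nat) \<Rightarrow> int" where
  "mon_deg \<mu> m =
     (\<Sum>g \<in> Poly_Mapping.keys m. int (Poly_Mapping.lookup m g) * gen_deg \<mu> g)"

definition A_SFT_part ::
  "nat \<Rightarrow> (side \<Rightarrow> nat set set) \<Rightarrow> (nat \<Rightarrow> int) \<Rightarrow> int \<Rightarrow> alg set" where
  "A_SFT_part n \<beta> \<mu> k = {p \<in> A_SFT n \<beta>. \<forall>m \<in> Poly_Mapping.keys p. mon_deg \<mu> m = k}"

text \<open>
  The case \<open>j = k\<close> and the case \<open>i = l\<close> for two \<open>\<alpha>\<close>'s exclude each other when \<open>i < j\<close> and \<open>k < l\<close>.
\<close>

fun gen_bracket :: "gen \<Rightarrow> gen \<Rightarrow> alg" where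
  "gen_bracket (Alpha x i j) (Alpha y k l) =
     (if x \<noteq> y then 0
      else if j = k then var (Alpha x i l)
      else if i = l then var (Alpha x k j)
      else 0)"
| "gen_bracket (Alpha x i j) (Beta y B) =
     (if x = y \<and> card ({i, j} \<inter> B) = 1 then var (Alpha x i j) else 0)"
| "gen_bracket (Beta y B) (Alpha x i j) =
     (if x = y \<and> card ({i, j} \<inter> B) = 1 then var (Alpha x i j) else 0)"
| "gen_bracket (Beta x B) (Beta y C) = 0"

definition bracket :: "alg \<Rightarrow> alg \<Rightarrow> alg" where
  "bracket p q = deriv_ext (\<lambda>g. deriv_ext (gen_bracket g) q) p"

text \<open>
  The following lemmas show that \<open>bracket\<close> is the unique symmetric bilinear map on \<open>A_SFT n \<beta>\<close>
  satisfying the Leibniz rule with the prescribed values on the generators.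
\<close>

lemma deriv_ext_add_fun: "deriv_ext (\<lambda>g. f g + f' g) p = deriv_ext f p + deriv_ext f' p"
  by (simp add: deriv_ext_def mon_deriv_def algebra_simps sum.distrib)

lemma deriv_ext_mult_fun: "deriv_ext (\<lambda>g. a * f g) p = a * deriv_ext f p"
  by (simp add: deriv_ext_def mon_deriv_def sum_distrib_left mult_ac)

lemma deriv_ext_mult_fun': "deriv_ext (\<lambda>g. f g * a) p = deriv_ext f p * a"
  using deriv_ext_mult_fun[of a f p] by (simp add: mult.commute)

lemma bracket_var: "bracket (var g) (var h) = gen_bracket g h"
  by (simp add: bracket_def deriv_ext_var)

lemma bracket_add_left: "bracket (p + p') q = bracket p q + bracket p' q"
  by (simp add: bracket_def deriv_ext_add)

lemma bracket_add_right: "bracket p (q + q') = bracket p q + bracket p q'"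
  by (simp add: bracket_def deriv_ext_add deriv_ext_add_fun)

lemma bracket_scal_right: "bracket p (scal c * q) = scal c * bracket p q"
  by (simp add: bracket_def deriv_ext_scal deriv_ext_mult_fun)

lemma bracket_mult_right: "bracket p (q * r) = bracket p q * r + q * bracket p r"
  unfolding bracket_def deriv_ext_mult deriv_ext_add_fun deriv_ext_mult_fun deriv_ext_mult_fun' ..

lemma gen_bracket_sym:
  assumes "g \<in> gens n \<beta>" "h \<in> gens n \<beta>"
  shows "gen_bracket g h = gen_bracket h g"
  using assms by (cases g; cases h) (auto simp: gens_def)

lemma bracket_sym:
  assumes p: "p \<in> A_SFT n \<beta>" and q: "q \<in> A_SFT n \<beta>"
  shows "bracket p q = bracket q p"
proof -
  have *: "bracket (var h) q = bracket q (var h)" if h: "h \<in> gens n \<beta>" for h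
  proof -
    have "bracket q (var h) = deriv_ext (gen_bracket h) q"
    proof (rule deriv_ext_unique[where S = "gens n \<beta>" and D = "\<lambda>q. bracket q (var h)"])
      show "bracket (var g) (var h) = gen_bracket h g" if "g \<in> gens n \<beta>" for g
        using gen_bracket_sym[OF that h] by (simp add: bracket_var)
      show "q \<in> polys (gens n \<beta>)" using q by (simp add: A_SFT_def)
    qed (simp_all add: bracket_def deriv_ext_add deriv_ext_scal deriv_ext_mult)
    then show ?thesis by (simp add: bracket_def deriv_ext_var)
  qed
  have "bracket q p = deriv_ext (\<lambda>g. deriv_ext (gen_bracket g) q) p"
  proof (rule deriv_ext_unique[where S = "gens n \<beta>" and D = "bracket q"])
    show "bracket q (var g) = deriv_ext (gen_bracket g) q" if "g \<in> gens n \<beta>" for g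
      using *[OF that] by (simp add: bracket_def deriv_ext_var)
    show "p \<in> polys (gens n \<beta>)" using p by (simp add: A_SFT_def)
    show "bracket q (scal c * r) = scal c * bracket q r" for c r
      by (rule bracket_scal_right)
  qed (simp_all only: bracket_add_right bracket_mult_right)
  then show ?thesis by (simp add: bracket_def)
qed

lemma scal_bit: "scal c * p = (if c = 1 then p else 0)" for c :: bit
  by (cases c) (simp_all add: scal_def)

lemma var_in_A_SFT: "g \<in> gens n \<beta> \<Longrightarrow> var g \<in> A_SFT n \<beta>"
  by (simp add: A_SFT_def polys_def var_def)

lemma bracket_unique:
  assumes sym: "\<And>p q. p \<in> A_SFT n \<beta> \<Longrightarrow> q \<in> A_SFT n \<beta> \<Longrightarrow> B p q = B q p"
    and add: "\<And>p q r. p \<in> A_SFT n \<beta> \<Longrightarrow> q \<in> A_SFT n \<beta> \<Longrightarrow> r \<in> A_SFT n \<beta> \<Longrightarrow>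
      B p (q + r) = B p q + B p r"
    and mult: "\<And>p q r. p \<in> A_SFT n \<beta> \<Longrightarrow> q \<in> A_SFT n \<beta> \<Longrightarrow> r \<in> A_SFT n \<beta> \<Longrightarrow>
      B p (q * r) = B p q * r + q * B p r"
    and gen: "\<And>g h. g \<in> gens n \<beta> \<Longrightarrow> h \<in> gens n \<beta> \<Longrightarrow> B (var g) (var h) = gen_bracket g h"
    and p: "p \<in> A_SFT n \<beta>" and q: "q \<in> A_SFT n \<beta>"
  shows "B p q = bracket p q"
proof -
  have z: "0 \<in> A_SFT n \<beta>" by (simp add: A_SFT_def polys_def)
  have zero: "B p 0 = 0" if "p \<in> A_SFT n \<beta>" for p
    using add[OF that z z] by simp
  have ext: "B p q = deriv_ext f q"
    if p: "p \<in> A_SFT n \<beta>" and q: "q \<in> A_SFT n \<beta>"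
      and f: "\<And>g. g \<in> gens n \<beta> \<Longrightarrow> B p (var g) = f g" for p q f
    by (rule deriv_ext_unique[where S = "gens n \<beta>" and D = "B p"])
      (use p q f in \<open>auto simp: A_SFT_def[symmetric] add mult scal_bit zero\<close>)
  have 1: "B (var g) q = deriv_ext (gen_bracket g) q" if g: "g \<in> gens n \<beta>" for g
    by (rule ext) (use g q in \<open>auto simp: var_in_A_SFT gen\<close>)
  have "B p q = B q p" using sym p q .
  also have "\<dots> = deriv_ext (\<lambda>g. deriv_ext (gen_bracket g) q) p"
    by (rule ext[OF q p]) (simp add: 1[symmetric] sym q var_in_A_SFT)
  finally show ?thesis by (simp add: bracket_def)
qed

definition hamiltonian :: "nat \<Rightarrow> alg" where
  "hamiltonian n = (\<Sum>i\<in>{1..n}. \<Sum>j\<in>{i<..n}. var (Alpha L i j) * var (Alpha R i j))"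

text \<open>
  \<open>trail \<beta> 0, trail \<beta> 1, \<dots>\<close> is the sequence \<open>1, \<beta>\<^sup>R(1), \<beta>\<^sup>L(\<beta>\<^sup>R(1)), \<dots>\<close>; the step from entry \<open>k\<close>
  to entry \<open>k + 1\<close> uses the pairing on the side \<open>step_side k\<close>.
\<close>

definition step_side :: "nat \<Rightarrow> side" where
  "step_side k = (if even k then R else L)"

fun trail :: "(side \<Rightarrow> nat set set) \<Rightarrow> nat \<Rightarrow> nat" where
  "trail \<beta> 0 = 1"
| "trail \<beta> (Suc k) = partner (\<beta> (step_side k)) (trail \<beta> k)"

definition gamma :: "(side \<Rightarrow> nat set set) \<Rightarrow> nat \<Rightarrow> alg" where
  "gamma \<beta> i = (\<Sum>k < (LEAST k. trail \<beta> k = i).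
      var (Beta (step_side k) {trail \<beta> k, trail \<beta> (Suc k)}))"

fun string_gen :: "(side \<Rightarrow> nat set set) \<Rightarrow> gen \<Rightarrow> alg" where
  "string_gen \<beta> (Alpha x i j) = (gamma \<beta> i + gamma \<beta> j) * var (Alpha x i j)
     + (\<Sum>k\<in>{i<..<j}. var (Alpha x i k) * var (Alpha x k j))"
| "string_gen \<beta> (Beta x B) = (var (Beta x B))^2"

definition d_string :: "(side \<Rightarrow> nat set set) \<Rightarrow> alg \<Rightarrow> alg" where
  "d_string \<beta> = deriv_ext (string_gen \<beta>)"

definition d_SFT :: "nat \<Rightarrow> (side \<Rightarrow> nat set set) \<Rightarrow> alg \<Rightarrow> alg" where
  "d_SFT n \<beta> p = bracket (hamiltonian n) p + d_string \<beta> p"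

end

theory Submission
  imports Defs
begin

text \<open>
  Let \<open>Y\<close> be the \<open>n \<times> n\<close> matrix with the \<open>\<alpha>\<^sup>L\<^bsub>ij\<^esub>\<close> above the diagonal, the \<open>\<alpha>\<^sup>R\<^bsub>ij\<^esub>\<close>, transposed,
  below it and the \<open>\<gamma>\<^sub>i\<close> on it. Write \<open>E\<^sub>p\<close> for \<open>(Y\<^sup>2)\<^bsub>pp\<^esub> + \<gamma>\<^sub>p\<^sup>2\<close>. Then the Hamiltonian bracket
  sends \<open>\<beta>\<^bsub>pq\<^esub>\<close> to \<open>E\<^sub>p + E\<^sub>q\<close>, the sum defining \<open>\<gamma>\<^sub>i\<close> telescopes, and the differential takes the form
  \<open>dY = Y\<^sup>2 + E\<^sub>1 I\<close>. Hence \<open>d(Y\<^sup>2) = 2 Y\<^sup>3 + 2 E\<^sub>1 Y = 0\<close>, so every \<open>E\<^sub>p\<close> is closed, and therefore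
  \<open>d\<^sup>2\<close>, which is a derivation in characteristic 2, vanishes on all generators.
\<close>

section \<open>Polynomials over the field with two elements\<close>

lemma alg_two_eq_zero [simp]: "(2 :: alg) = 0"
proof -
  have "(1 :: alg) + 1 = Poly_Mapping.single 0 (1 + 1)"
    by (simp only: single_add single_one)
  then show ?thesis by simp
qed

lemma alg_add_self [simp]: "p + p = (0 :: alg)"
  by (simp flip: mult_2)

text \<open>Additivity of the Frobenius map. In \<open>d_SFT_gamma\<close> it assembles the squares
  of single generators into the square of their sum.\<close>

lemma alg_add_square: "(p + q)\<^sup>2 = p\<^sup>2 + (q :: alg)\<^sup>2"
  by (simp add: power2_sum)

lemma deriv_ext_sum: "deriv_ext f (\<Sum>i\<in>I. p i) = (\<Sum>i\<in>I. deriv_ext f (p i))"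
  by (induction I rule: infinite_finite_induct) (simp_all add: deriv_ext_add)

lemma deriv_ext_one [simp]: "deriv_ext f 1 = 0"
  using deriv_ext_const[of f 1] by (simp add: scal_def)

section \<open>The grading\<close>

lemma zero_in_polys [simp]: "0 \<in> polys S"
  by (simp add: polys_def)

lemma polys_add: "p \<in> polys S \<Longrightarrow> q \<in> polys S \<Longrightarrow> p + q \<in> polys S"
  using keys_add[of p q] unfolding polys_def by blast

lemma polys_mult:
  assumes "p \<in> polys S" "q \<in> polys S"
  shows "p * q \<in> polys S"
  unfolding polys_def
proof (intro CollectI ballI)
  fix m assume "m \<in> Poly_Mapping.keys (p * q)"
  then obtain a b where "m = a + b" "a \<in> Poly_Mapping.keys p" "b \<in> Poly_Mapping.keys q"
    using keys_mult[of p q] by blast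
  with assms show "Poly_Mapping.keys m \<subseteq> S"
    using keys_add[of a b] by (simp add: polys_def) blast
qed

lemma deriv_ext_in_polys:
  assumes "p \<in> polys S" "\<And>g. g \<in> S \<Longrightarrow> f g \<in> polys S"
  shows "deriv_ext f p \<in> polys S"
  using assms(1)
proof (induction p rule: polys_induct)
  case (scal c p)
  have "scal c \<in> polys S"
    by (simp add: polys_def scal_def)
  with scal show ?case by (simp add: deriv_ext_scal polys_mult)
qed (simp_all add: assms deriv_ext_var deriv_ext_mult deriv_ext_add polys_add polys_mult)

lemma mon_deg_superset:
  assumes "finite K" "Poly_Mapping.keys m \<subseteq> K"
  shows "mon_deg \<mu> m = (\<Sum>g\<in>K. int (Poly_Mapping.lookup m g) * gen_deg \<mu> g)"
  unfolding mon_deg_def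
  by (rule sum.mono_neutral_left) (use assms in \<open>auto simp: in_keys_iff\<close>)

lemma mon_deg_zero [simp]: "mon_deg \<mu> 0 = 0"
  by (simp add: mon_deg_def)

lemma mon_deg_single [simp]: "mon_deg \<mu> (Poly_Mapping.single g (Suc 0)) = gen_deg \<mu> g"
  by (simp add: mon_deg_def)

lemma mon_deg_add: "mon_deg \<mu> (a + b) = mon_deg \<mu> a + mon_deg \<mu> b"
proof -
  let ?K = "Poly_Mapping.keys a \<union> Poly_Mapping.keys b"
  show ?thesis
    using mon_deg_superset[of ?K "a + b" \<mu>] mon_deg_superset[of ?K a \<mu>] mon_deg_superset[of ?K b \<mu>]
    by (simp add: keys_add lookup_add algebra_simps sum.distrib)
qed

lemma part_subset: "A_SFT_part n \<beta> \<mu> k \<subseteq> A_SFT n \<beta>"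
  by (auto simp: A_SFT_part_def)

lemma zero_in_part [simp]: "0 \<in> A_SFT_part n \<beta> \<mu> k"
  by (simp add: A_SFT_part_def A_SFT_def polys_def)

lemma single_zero_in_part: "Poly_Mapping.single 0 c \<in> A_SFT_part n \<beta> \<mu> 0"
  by (simp add: A_SFT_part_def A_SFT_def polys_def)

lemma one_in_part: "1 \<in> A_SFT_part n \<beta> \<mu> 0"
  using single_zero_in_part[of 1] by simp

lemma part_add:
  "p \<in> A_SFT_part n \<beta> \<mu> k \<Longrightarrow> q \<in> A_SFT_part n \<beta> \<mu> k \<Longrightarrow> p + q \<in> A_SFT_part n \<beta> \<mu> k"
  using keys_add[of p q] by (simp add: A_SFT_part_def A_SFT_def polys_add) blast

lemma part_mult:
  assumes "p \<in> A_SFT_part n \<beta> \<mu> k" "q \<in> A_SFT_part n \<beta> \<mu> l"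
  shows "p * q \<in> A_SFT_part n \<beta> \<mu> (k + l)"
  unfolding A_SFT_part_def
proof (intro CollectI conjI ballI)
  show "p * q \<in> A_SFT n \<beta>"
    using assms by (simp add: A_SFT_part_def A_SFT_def polys_mult)
  fix m assume "m \<in> Poly_Mapping.keys (p * q)"
  then obtain a b where "m = a + b" "a \<in> Poly_Mapping.keys p" "b \<in> Poly_Mapping.keys q"
    using keys_mult[of p q] by blast
  with assms show "mon_deg \<mu> m = k + l"
    by (simp add: A_SFT_part_def mon_deg_add)
qed

lemma part_sum:
  "(\<And>i. i \<in> I \<Longrightarrow> p i \<in> A_SFT_part n \<beta> \<mu> k) \<Longrightarrow> (\<Sum>i\<in>I. p i) \<in> A_SFT_part n \<beta> \<mu> k"
  by (induction I rule: infinite_finite_induct) (auto intro: part_add)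

lemma of_nat_in_part: "of_nat c \<in> A_SFT_part n \<beta> \<mu> 0"
  by (induction c) (auto intro: part_add one_in_part)

lemma var_in_part: "g \<in> gens n \<beta> \<Longrightarrow> var g \<in> A_SFT_part n \<beta> \<mu> (gen_deg \<mu> g)"
  by (simp add: A_SFT_part_def var_in_A_SFT) (simp add: var_def)

text \<open>Each term of a derivative replaces one factor \<open>g\<close> of a monomial by
  \<open>f g\<close>, which shifts the degree by \<open>e\<close>. The differential is the case
  \<open>e = -1\<close>.\<close>

lemma deriv_ext_in_part:
  assumes p: "p \<in> A_SFT_part n \<beta> \<mu> k"
    and f: "\<And>g. g \<in> gens n \<beta> \<Longrightarrow> f g \<in> A_SFT_part n \<beta> \<mu> (gen_deg \<mu> g + e)"
  shows "deriv_ext f p \<in> A_SFT_part n \<beta> \<mu> (k + e)"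
proof -
  have mon: "of_nat c * Poly_Mapping.single (m - Poly_Mapping.single g 1) 1 * f g
      \<in> A_SFT_part n \<beta> \<mu> (k + e)"
    if m: "m \<in> Poly_Mapping.keys p" and g: "g \<in> Poly_Mapping.keys m" for m g c
  proof -
    define m' where "m' = m - Poly_Mapping.single g 1"
    have m': "m = Poly_Mapping.single g 1 + m'"
      unfolding m'_def
      by (rule poly_mapping_eqI)
        (use g in \<open>auto simp: lookup_add lookup_minus lookup_single when_def in_keys_iff\<close>)
    have "mon_deg \<mu> m = gen_deg \<mu> g + mon_deg \<mu> m'"
      by (subst m') (simp add: mon_deg_add)
    moreover have "mon_deg \<mu> m = k"
      using p m by (simp add: A_SFT_part_def)
    ultimately have deg: "mon_deg \<mu> m' = k - gen_deg \<mu> g"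
      by simp
    have sub: "Poly_Mapping.keys m \<subseteq> gens n \<beta>"
      using p m by (auto simp: A_SFT_part_def A_SFT_def polys_def)
    moreover have "Poly_Mapping.keys m' \<subseteq> Poly_Mapping.keys m"
      by (auto simp: m'_def in_keys_iff lookup_minus)
    ultimately have s: "Poly_Mapping.single m' 1 \<in> A_SFT_part n \<beta> \<mu> (k - gen_deg \<mu> g)"
      using deg by (auto simp: A_SFT_part_def A_SFT_def polys_def)
    have "f g \<in> A_SFT_part n \<beta> \<mu> (gen_deg \<mu> g + e)"
      using f sub g by blast
    from part_mult[OF part_mult[OF of_nat_in_part s] this] show ?thesis
      by (simp add: m'_def)
  qed
  have scal: "scal c * q \<in> A_SFT_part n \<beta> \<mu> l" if "q \<in> A_SFT_part n \<beta> \<mu> l" for c q l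
    using part_mult[OF single_zero_in_part that] by (simp add: scal_def)
  show ?thesis
    unfolding deriv_ext_def mon_deriv_def by (intro part_sum scal mon)
qed

lemma subalgebra2_A_SFT: "subalgebra2 (A_SFT n \<beta>)"
  using part_subset[THEN subsetD, OF one_in_part] part_subset[THEN subsetD, OF zero_in_part]
  by (auto simp: subalgebra2_def A_SFT_def polys_add polys_mult)

lemma graded_by_A_SFT: "graded_by (A_SFT n \<beta>) (A_SFT_part n \<beta> \<mu>)"
proof -
  have "\<exists>!c. finite {k. c k \<noteq> 0} \<and> (\<forall>k. c k \<in> A_SFT_part n \<beta> \<mu> k) \<and> x = (\<Sum>k | c k \<noteq> 0. c k)"
    if x: "x \<in> A_SFT n \<beta>" for x
  proof -
    define c where "c k = (\<Sum>m | m \<in> Poly_Mapping.keys x \<and> mon_deg \<mu> m = k.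
        Poly_Mapping.single m (Poly_Mapping.lookup x m))" for k
    have look: "Poly_Mapping.lookup (c k) m = (if mon_deg \<mu> m = k then Poly_Mapping.lookup x m else 0)"
      for k m
    proof -
      have "Poly_Mapping.lookup (c k) m
          = (\<Sum>m' | m' \<in> Poly_Mapping.keys x \<and> mon_deg \<mu> m' = k.
              if m' = m then Poly_Mapping.lookup x m else 0)"
        unfolding c_def lookup_sum lookup_single when_def by (intro sum.cong) auto
      also have "\<dots> = (if m \<in> Poly_Mapping.keys x \<and> mon_deg \<mu> m = k then Poly_Mapping.lookup x m else 0)"
        by (subst sum.delta) auto
      finally show ?thesis by (simp add: in_keys_iff)
    qed
    have supp: "{k. c k \<noteq> 0} \<subseteq> mon_deg \<mu> ` Poly_Mapping.keys x"
    proof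
      fix k assume "k \<in> {k. c k \<noteq> 0}"
      then have "\<exists>m. Poly_Mapping.lookup (c k) m \<noteq> 0"
        by (simp add: poly_mapping_eq_iff fun_eq_iff)
      then obtain m where "Poly_Mapping.lookup (c k) m \<noteq> 0" ..
      then show "k \<in> mon_deg \<mu> ` Poly_Mapping.keys x"
        by (auto simp: look in_keys_iff split: if_splits)
    qed
    then have fin: "finite {k. c k \<noteq> 0}"
      by (rule finite_subset) simp
    have part: "c k \<in> A_SFT_part n \<beta> \<mu> k" for k
      using x by (auto simp: A_SFT_part_def A_SFT_def polys_def in_keys_iff look split: if_splits)
    \<comment> \<open>A monomial \<open>m\<close> can only occur in the component of index
      \<open>mon_deg \<mu> m\<close>. Applied to \<open>c\<close> this gives existence of the
      decomposition, applied to an arbitrary \<open>b\<close> its uniqueness.\<close>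
    have lookup_homog: "Poly_Mapping.lookup (\<Sum>k | b k \<noteq> 0. b k) m = Poly_Mapping.lookup (b (mon_deg \<mu> m)) m"
      if b: "finite {k. b k \<noteq> 0}" "\<And>k. b k \<in> A_SFT_part n \<beta> \<mu> k" for b m
    proof -
      have "Poly_Mapping.lookup (b k) m = 0" if "k \<noteq> mon_deg \<mu> m" for k
        using b(2)[of k] that by (auto simp: A_SFT_part_def in_keys_iff)
      then have "Poly_Mapping.lookup (\<Sum>k | b k \<noteq> 0. b k) m
          = (\<Sum>k | b k \<noteq> 0. if k = mon_deg \<mu> m then Poly_Mapping.lookup (b (mon_deg \<mu> m)) m else 0)"
        unfolding lookup_sum by (intro sum.cong) auto
      then show ?thesis using b(1) by auto
    qed
    have "x = (\<Sum>k | c k \<noteq> 0. c k)"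
      by (rule poly_mapping_eqI) (simp add: lookup_homog[OF fin part] look)
    then have "finite {k. c k \<noteq> 0} \<and> (\<forall>k. c k \<in> A_SFT_part n \<beta> \<mu> k) \<and> x = (\<Sum>k | c k \<noteq> 0. c k)"
      using fin part by blast
    moreover have "b = c"
      if b: "finite {k. b k \<noteq> 0} \<and> (\<forall>k. b k \<in> A_SFT_part n \<beta> \<mu> k) \<and> x = (\<Sum>k | b k \<noteq> 0. b k)" for b
    proof (intro ext poly_mapping_eqI)
      fix k m
      show "Poly_Mapping.lookup (b k) m = Poly_Mapping.lookup (c k) m"
      proof (cases "mon_deg \<mu> m = k")
        case True
        have "Poly_Mapping.lookup x m = Poly_Mapping.lookup (b (mon_deg \<mu> m)) m"
          using lookup_homog[of b m] b by metis
        with True show ?thesis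
          by (simp add: look)
      next
        case False
        moreover have "b k \<in> A_SFT_part n \<beta> \<mu> k"
          using b by blast
        ultimately show ?thesis
          by (auto simp: look A_SFT_part_def in_keys_iff)
      qed
    qed
    ultimately show ?thesis
      by (rule ex1I)
  qed
  then show ?thesis
    by (simp add: graded_by_def part_subset one_in_part part_add part_mult)
qed

section \<open>The differential as a derivation\<close>

lemma d_SFT_add: "d_SFT n \<beta> (p + q) = d_SFT n \<beta> p + d_SFT n \<beta> q"
  by (simp add: d_SFT_def d_string_def bracket_add_right deriv_ext_add algebra_simps)

lemma d_SFT_mult: "d_SFT n \<beta> (p * q) = d_SFT n \<beta> p * q + p * d_SFT n \<beta> q"
  by (simp add: d_SFT_def d_string_def bracket_mult_right deriv_ext_mult algebra_simps)

lemma d_SFT_zero [simp]: "d_SFT n \<beta> 0 = 0"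
  using d_SFT_add[of n \<beta> 0 0] by simp

lemma d_SFT_sum: "d_SFT n \<beta> (\<Sum>i\<in>I. p i) = (\<Sum>i\<in>I. d_SFT n \<beta> (p i))"
  by (induction I rule: infinite_finite_induct) (simp_all add: d_SFT_add)

text \<open>The Leibniz rule produces the same product twice, which cancels in characteristic
  2.\<close>

lemma d_SFT_square [simp]: "d_SFT n \<beta> (p\<^sup>2) = 0"
  by (simp add: power2_eq_square d_SFT_mult mult.commute)

text \<open>Reduces closure of the algebra under the differential, and the degree of the
  differential, to values on generators.\<close>

lemma d_SFT_deriv_ext: "d_SFT n \<beta> p = deriv_ext (\<lambda>g. d_SFT n \<beta> (var g)) p"
  by (rule deriv_ext_unique[where S = UNIV])
    (simp_all add: d_SFT_add d_SFT_mult scal_bit polys_def)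

text \<open>In the second differential of \<open>p * q\<close> the cross term
  \<open>d_SFT n \<beta> p * d_SFT n \<beta> q\<close> occurs twice and cancels. So the squared
  differential satisfies the Leibniz rule and, vanishing on generators, is the zero
  derivation.\<close>

lemma d_SFT_squared_zero:
  assumes p: "p \<in> polys S" and gen: "\<And>g. g \<in> S \<Longrightarrow> d_SFT n \<beta> (d_SFT n \<beta> (var g)) = 0"
  shows "d_SFT n \<beta> (d_SFT n \<beta> p) = 0"
proof -
  have "d_SFT n \<beta> (d_SFT n \<beta> p) = deriv_ext (\<lambda>g. 0) p"
    by (rule deriv_ext_unique[where S = S])
      (use p gen in \<open>simp_all add: d_SFT_add d_SFT_mult scal_bit add.assoc\<close>)
  also have "\<dots> = 0"
    by (simp add: deriv_ext_def mon_deriv_def)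
  finally show ?thesis .
qed

text \<open>By definition \<open>bracket\<close> is a derivation in its left argument, so the
  Leibniz rule applies directly to the products in the Hamiltonian.\<close>

lemma bracket_hamiltonian_var:
  "bracket (hamiltonian n) (var g) = (\<Sum>i\<in>{1..n}. \<Sum>j\<in>{i<..n}.
      gen_bracket (Alpha L i j) g * var (Alpha R i j) + var (Alpha L i j) * gen_bracket (Alpha R i j) g)"
  by (simp add: bracket_def hamiltonian_def deriv_ext_sum deriv_ext_mult deriv_ext_var)

text \<open>Together with \<open>sum_pairs_snd\<close>, this extracts the terms of the Hamiltonian
  that have a nonzero bracket with a given generator.\<close>

lemma sum_pairs_fst:
  fixes f :: "nat \<Rightarrow> nat \<Rightarrow> 'a::comm_monoid_add"
  assumes "p \<in> {1..n}"
  shows "(\<Sum>i\<in>{1..n}. \<Sum>j\<in>{i<..n}. if i = p then f i j else 0) = (\<Sum>j\<in>{p<..n}. f p j)"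
proof -
  have "(\<Sum>i\<in>{1..n}. \<Sum>j\<in>{i<..n}. if i = p then f i j else 0)
      = (\<Sum>i\<in>{1..n}. if i = p then \<Sum>j\<in>{p<..n}. f p j else 0)"
    by (intro sum.cong) auto
  then show ?thesis using assms by simp
qed

lemma sum_pairs_snd:
  fixes f :: "nat \<Rightarrow> nat \<Rightarrow> 'a::comm_monoid_add"
  assumes "p \<in> {1..n}"
  shows "(\<Sum>i\<in>{1..n}. \<Sum>j\<in>{i<..n}. if j = p then f i j else 0) = (\<Sum>i\<in>{1..<p}. f i p)"
proof -
  have "(\<Sum>i\<in>{1..n}. \<Sum>j\<in>{i<..n}. if j = p then f i j else 0)
      = (\<Sum>i\<in>{1..n}. if i \<in> {1..<p} then f i p else 0)"
    using assms by (intro sum.cong) auto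
  also have "\<dots> = (\<Sum>i\<in>{1..n} \<inter> {1..<p}. f i p)"
    by (simp add: sum.inter_restrict)
  also have "{1..n} \<inter> {1..<p} = {1..<p}"
    using assms by auto
  finally show ?thesis .
qed

section \<open>The matrix form of the differential\<close>

text \<open>The \<gamma>'s on the diagonal make the terms
  \<open>(gamma \<beta> i + gamma \<beta> j) * var (Alpha x i j)\<close> of the string differential
  part of the matrix square.\<close>

definition Ymat :: "(side \<Rightarrow> nat set set) \<Rightarrow> nat \<Rightarrow> nat \<Rightarrow> alg" where
  "Ymat \<beta> i j = (if i < j then var (Alpha L i j) else if j < i then var (Alpha R j i) else gamma \<beta> i)"

definition Ysq :: "nat \<Rightarrow> (side \<Rightarrow> nat set set) \<Rightarrow> nat \<Rightarrow> nat \<Rightarrow> alg" where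
  "Ysq n \<beta> i j = (\<Sum>k\<in>{1..n}. Ymat \<beta> i k * Ymat \<beta> k j)"

definition Ediag :: "nat \<Rightarrow> (side \<Rightarrow> nat set set) \<Rightarrow> nat \<Rightarrow> alg" where
  "Ediag n \<beta> p = Ysq n \<beta> p p + (gamma \<beta> p)\<^sup>2"

lemma sum_split_at:
  fixes f :: "nat \<Rightarrow> 'a::comm_monoid_add"
  assumes "i \<in> {1..n}"
  shows "(\<Sum>k\<in>{1..n}. f k) = (\<Sum>k\<in>{1..<i}. f k) + f i + (\<Sum>k\<in>{i<..n}. f k)"
proof -
  have "{1..n} = {1..<i} \<union> ({i} \<union> {i<..n})"
    using assms by auto
  then show ?thesis
    by (simp add: sum.union_disjoint add_ac disjoint_iff)
qed

lemma sum_split_at2: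
  fixes f :: "nat \<Rightarrow> 'a::comm_monoid_add"
  assumes "1 \<le> i" "i < j" "j \<le> n"
  shows "(\<Sum>k\<in>{1..n}. f k)
      = (\<Sum>k\<in>{1..<i}. f k) + f i + (\<Sum>k\<in>{i<..<j}. f k) + f j + (\<Sum>k\<in>{j<..n}. f k)"
proof -
  have "{i<..n} = {i<..<j} \<union> ({j} \<union> {j<..n})"
    using assms by auto
  then have "(\<Sum>k\<in>{i<..n}. f k) = (\<Sum>k\<in>{i<..<j}. f k) + (f j + (\<Sum>k\<in>{j<..n}. f k))"
    by (simp add: sum.union_disjoint add_ac disjoint_iff)
  then show ?thesis
    using sum_split_at[of i n f] assms by (simp add: add.assoc)
qed

text \<open>The summand \<open>k = p\<close> of \<open>Ysq n \<beta> p p\<close> is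
  \<open>(gamma \<beta> p)\<^sup>2\<close> and cancels against the added square. What remains are
  the Hamiltonian terms that involve the index \<open>p\<close>.\<close>

lemma Ediag_eq:
  assumes p: "p \<in> {1..n}"
  shows "Ediag n \<beta> p = (\<Sum>i\<in>{1..<p}. var (Alpha L i p) * var (Alpha R i p))
      + (\<Sum>j\<in>{p<..n}. var (Alpha L p j) * var (Alpha R p j))"
proof -
  have "Ysq n \<beta> p p = (\<Sum>i\<in>{1..<p}. Ymat \<beta> p i * Ymat \<beta> i p) + (gamma \<beta> p)\<^sup>2
      + (\<Sum>j\<in>{p<..n}. Ymat \<beta> p j * Ymat \<beta> j p)"
    unfolding Ysq_def sum_split_at[OF p] by (simp add: Ymat_def power2_eq_square)
  then show ?thesis
    by (simp add: Ediag_def Ymat_def algebra_simps)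
qed

text \<open>Split the sum over \<open>k\<close> in \<open>Ysq n \<beta> i j\<close> at
  \<open>i\<close> and \<open>j\<close>. The outer ranges come from the Hamiltonian, the range
  between \<open>i\<close> and \<open>j\<close> from the quadratic part of the string differential,
  and \<open>k = i\<close>, \<open>k = j\<close> from its \<gamma> part.\<close>

lemma d_SFT_Alpha_L:
  assumes ij: "1 \<le> i" "i < j" "j \<le> n"
  shows "d_SFT n \<beta> (var (Alpha L i j)) = Ysq n \<beta> i j"
proof -
  have i: "i \<in> {1..n}" and j: "j \<in> {1..n}"
    using ij by auto
  \<comment> \<open>The cases \<open>l = i\<close> and \<open>k = j\<close> exclude each other, as
    together they would give \<open>k < l = i < j = k\<close>. Hence the nested conditional of
    \<open>gen_bracket\<close> becomes a sum of two.\<close>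
  have "bracket (hamiltonian n) (var (Alpha L i j))
      = (\<Sum>k\<in>{1..n}. \<Sum>l\<in>{k<..n}. (if l = i then var (Alpha L k j) * var (Alpha R k l) else 0)
          + (if k = j then var (Alpha L i l) * var (Alpha R k l) else 0))"
    unfolding bracket_hamiltonian_var by (intro sum.cong) (use ij in auto)
  also have "\<dots> = (\<Sum>k\<in>{1..<i}. var (Alpha L k j) * var (Alpha R k i))
      + (\<Sum>l\<in>{j<..n}. var (Alpha L i l) * var (Alpha R j l))"
    unfolding sum.distrib sum_pairs_snd[OF i] sum_pairs_fst[OF j] ..
  finally show ?thesis
    unfolding Ysq_def sum_split_at2[OF ij] using ij
    by (simp add: d_SFT_def d_string_def deriv_ext_var Ymat_def algebra_simps)
qed

text \<open>The same splitting works at the transposed position \<open>(j, i)\<close>, which is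
  where \<open>Ymat\<close> stores this generator.\<close>

lemma d_SFT_Alpha_R:
  assumes ij: "1 \<le> i" "i < j" "j \<le> n"
  shows "d_SFT n \<beta> (var (Alpha R i j)) = Ysq n \<beta> j i"
proof -
  have i: "i \<in> {1..n}" and j: "j \<in> {1..n}"
    using ij by auto
  have "bracket (hamiltonian n) (var (Alpha R i j))
      = (\<Sum>k\<in>{1..n}. \<Sum>l\<in>{k<..n}. (if l = i then var (Alpha L k l) * var (Alpha R k j) else 0)
          + (if k = j then var (Alpha L k l) * var (Alpha R i l) else 0))"
    unfolding bracket_hamiltonian_var by (intro sum.cong) (use ij in auto)
  also have "\<dots> = (\<Sum>k\<in>{1..<i}. var (Alpha L k i) * var (Alpha R k j))
      + (\<Sum>l\<in>{j<..n}. var (Alpha L j l) * var (Alpha R i l))"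
    unfolding sum.distrib sum_pairs_snd[OF i] sum_pairs_fst[OF j] ..
  finally show ?thesis
    unfolding Ysq_def sum_split_at2[OF ij] using ij
    by (simp add: d_SFT_def d_string_def deriv_ext_var Ymat_def algebra_simps)
qed

lemma d_SFT_Beta:
  assumes pq: "p \<in> {1..n}" "q \<in> {1..n}" "p \<noteq> q"
  shows "d_SFT n \<beta> (var (Beta x {p, q})) = (var (Beta x {p, q}))\<^sup>2 + Ediag n \<beta> p + Ediag n \<beta> q"
proof -
  let ?c = "\<lambda>i j. var (Alpha L i j) * var (Alpha R i j) :: alg"
  \<comment> \<open>Bracketing with \<open>Beta x B\<close> returns the \<alpha> of side
    \<open>x\<close> itself, so the product is the same for both values of \<open>x\<close>.\<close>
  have side: "gen_bracket (Alpha L i j) (Beta x B) * var (Alpha R i j)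
        + var (Alpha L i j) * gen_bracket (Alpha R i j) (Beta x B)
      = (if card ({i, j} \<inter> B) = 1 then ?c i j else 0)" for i j B
    by (cases x) auto
  have "card ({i, j} \<inter> {p, q}) = (if i \<in> {p, q} then 1 else 0) + (if j \<in> {p, q} then 1 else 0)"
    if "i < j" for i j
    using that by (auto simp: Int_insert_left)
  \<comment> \<open>Modulo 2, "exactly one index lies in \<open>{p, q}\<close>" is a sum of four
    indicators: if \<open>{i, j} = {p, q}\<close>, two of them hold and their contributions
    cancel.\<close>
  then have ind: "(if card ({i, j} \<inter> {p, q}) = 1 then ?c i j else 0)
      = ((if j = p then ?c i j else 0) + (if i = p then ?c i j else 0))
        + ((if j = q then ?c i j else 0) + (if i = q then ?c i j else 0))" if "i < j" for i j
    using that pq(3) by auto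
  have "bracket (hamiltonian n) (var (Beta x {p, q}))
      = (\<Sum>i\<in>{1..n}. \<Sum>j\<in>{i<..n}. ((if j = p then ?c i j else 0) + (if i = p then ?c i j else 0))
        + ((if j = q then ?c i j else 0) + (if i = q then ?c i j else 0)))"
    unfolding bracket_hamiltonian_var side by (intro sum.cong refl ind) auto
  also have "\<dots> = Ediag n \<beta> p + Ediag n \<beta> q"
    unfolding sum.distrib sum_pairs_fst[OF pq(1)] sum_pairs_fst[OF pq(2)]
      sum_pairs_snd[OF pq(1)] sum_pairs_snd[OF pq(2)] Ediag_eq[OF pq(1)] Ediag_eq[OF pq(2)] ..
  finally show ?thesis
    by (simp add: d_SFT_def d_string_def deriv_ext_var algebra_simps)
qed

section \<open>Telescoping along the trail and vanishing of the squared differential\<close>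

locale pairings =
  fixes n :: nat and \<beta> :: "side \<Rightarrow> nat set set"
  assumes pairing: "pairing n (\<beta> x)"
    and range_trail: "range (trail \<beta>) = {1..n}"
begin

lemma trail_in: "trail \<beta> k \<in> {1..n}"
  using range_trail rangeI[of "trail \<beta>" k] by simp

lemma Beta_trail:
  "{trail \<beta> k, trail \<beta> (Suc k)} \<in> \<beta> (step_side k)" "trail \<beta> k \<noteq> trail \<beta> (Suc k)"
  using partner(1,2)[OF pairing trail_in[of k], of "step_side k"] by auto

lemma d_SFT_gamma:
  assumes i: "i \<in> {1..n}"
  shows "d_SFT n \<beta> (gamma \<beta> i) = (gamma \<beta> i)\<^sup>2 + Ediag n \<beta> i + Ediag n \<beta> 1"
proof -
  let ?G = "\<lambda>m. \<Sum>k<m. var (Beta (step_side k) {trail \<beta> k, trail \<beta> (Suc k)}) :: alg"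
  \<comment> \<open>Each step adds the \<beta> joining consecutive entries of the trail, so the
    intermediate \<open>Ediag\<close> terms cancel in pairs. For \<open>m = 0\<close> the trail is
    at 1 and the two \<open>Ediag\<close> terms cancel.\<close>
  have "d_SFT n \<beta> (?G m) = (?G m)\<^sup>2 + Ediag n \<beta> (trail \<beta> m) + Ediag n \<beta> 1" for m
  proof (induction m)
    case (Suc m)
    have "d_SFT n \<beta> (?G (Suc m)) = d_SFT n \<beta> (?G m)
        + d_SFT n \<beta> (var (Beta (step_side m) {trail \<beta> m, trail \<beta> (Suc m)}))"
      by (simp add: d_SFT_add)
    also note Suc.IH
    also note d_SFT_Beta[OF trail_in trail_in Beta_trail(2)]
    finally show ?case
      by (simp add: alg_add_square algebra_simps del: trail.simps)
  qed simp
  moreover obtain k where "trail \<beta> k = i"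
    using i range_trail by (metis imageE)
  \<comment> \<open>Since the trail visits every index, the \<open>LEAST\<close> in
    \<open>gamma\<close> is attained and the telescoped sum ends at \<open>i\<close>.\<close>
  then have "trail \<beta> (LEAST k. trail \<beta> k = i) = i"
    by (rule LeastI)
  ultimately show ?thesis
    by (simp add: gamma_def del: trail.simps)
qed

text \<open>On the diagonal, \<open>(gamma \<beta> i)\<^sup>2 + Ediag n \<beta> i\<close> collapses
  to \<open>Ysq n \<beta> i i\<close>. The remaining \<open>Ediag n \<beta> 1\<close> is the same
  for all \<open>i\<close>, hence a scalar matrix.\<close>

lemma d_SFT_Ymat:
  assumes "i \<in> {1..n}" "j \<in> {1..n}"
  shows "d_SFT n \<beta> (Ymat \<beta> i j) = Ysq n \<beta> i j + (if i = j then Ediag n \<beta> 1 else 0)"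
proof -
  consider "i < j" | "j < i" | "i = j" by linarith
  then show ?thesis
  proof cases
    case 3
    then show ?thesis
      using assms by (simp add: Ymat_def d_SFT_gamma Ediag_def add_ac)
  qed (use assms in \<open>simp_all add: Ymat_def d_SFT_Alpha_L d_SFT_Alpha_R\<close>)
qed

lemma d_SFT_Ysq:
  assumes ij: "i \<in> {1..n}" "j \<in> {1..n}"
  shows "d_SFT n \<beta> (Ysq n \<beta> i j) = 0"
proof -
  let ?N = "{1..n}" and ?E = "Ediag n \<beta> 1" and ?Y = "Ymat \<beta>"
  have "d_SFT n \<beta> (Ysq n \<beta> i j)
      = (\<Sum>k\<in>?N. (Ysq n \<beta> i k + (if i = k then ?E else 0)) * ?Y k j
          + ?Y i k * (Ysq n \<beta> k j + (if k = j then ?E else 0)))"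
    unfolding Ysq_def[of n \<beta> i j] d_SFT_sum d_SFT_mult
    by (intro sum.cong) (use ij in \<open>simp_all add: d_SFT_Ymat\<close>)
  also have "\<dots> = ((\<Sum>k\<in>?N. Ysq n \<beta> i k * ?Y k j) + (\<Sum>k\<in>?N. ?Y i k * Ysq n \<beta> k j))
      + ((\<Sum>k\<in>?N. if i = k then ?E * ?Y k j else 0) + (\<Sum>k\<in>?N. if k = j then ?Y i k * ?E else 0))"
    unfolding sum.distrib[symmetric] by (intro sum.cong) (auto simp: algebra_simps)
  \<comment> \<open>Associativity of the matrix product: both sides are the \<open>(i, j)\<close>
    entry of the cube.\<close>
  also have "(\<Sum>k\<in>?N. Ysq n \<beta> i k * ?Y k j) = (\<Sum>k\<in>?N. ?Y i k * Ysq n \<beta> k j)"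
    unfolding Ysq_def sum_distrib_left sum_distrib_right
    by (subst sum.swap) (simp add: mult.assoc)
  \<comment> \<open>Both sums pick out \<open>?E * ?Y i j\<close>, as the scalar matrix commutes
    with \<open>?Y\<close>.\<close>
  also have "(\<Sum>k\<in>?N. if i = k then ?E * ?Y k j else 0) = (\<Sum>k\<in>?N. if k = j then ?Y i k * ?E else 0)"
    using ij by (simp add: mult.commute)
  finally show ?thesis by simp
qed

lemma d_SFT_Ediag: "p \<in> {1..n} \<Longrightarrow> d_SFT n \<beta> (Ediag n \<beta> p) = 0"
  by (simp add: Ediag_def d_SFT_add d_SFT_Ysq)

text \<open>Presents each generator in the form that the formulas for its differential require, in
  particular a block of a pairing as two distinct indices.\<close>

lemma gens_cases:
  assumes "g \<in> gens n \<beta>"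
  obtains (Alpha_L) i j where "g = Alpha L i j" "1 \<le> i" "i < j" "j \<le> n"
  | (Alpha_R) i j where "g = Alpha R i j" "1 \<le> i" "i < j" "j \<le> n"
  | (Beta) x p q where "g = Beta x {p, q}" "{p, q} \<in> \<beta> x" "p \<in> {1..n}" "q \<in> {1..n}" "p \<noteq> q"
proof (cases g)
  case (Alpha x i j)
  then show ?thesis
    using assms that(1)[of i j] that(2)[of i j] by (cases x) (auto simp: gens_def)
next
  case (Beta x B)
  then have B: "B \<in> \<beta> x" using assms by (auto simp: gens_def)
  moreover from B obtain p q where "B = {p, q}" "p \<noteq> q"
    using pairing[of x] by (auto simp: pairing_def card_2_iff)
  moreover have "B \<subseteq> {1..n}"
    using B pairing[of x] by (auto simp: pairing_def partition_on_def)
  ultimately show ?thesis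
    using Beta that(3)[of x p q] by simp
qed

text \<open>The first differential is an entry of \<open>Ysq\<close>, or a square plus two
  \<open>Ediag\<close> terms; all of these are closed.\<close>

lemma d_SFT_d_SFT_var:
  assumes "g \<in> gens n \<beta>"
  shows "d_SFT n \<beta> (d_SFT n \<beta> (var g)) = 0"
  using assms
  by (cases rule: gens_cases)
    (simp_all add: d_SFT_Alpha_L d_SFT_Alpha_R d_SFT_Beta d_SFT_Ysq d_SFT_add d_SFT_Ediag)

section \<open>Degrees of the matrix entries and of the differential\<close>

lemma gamma_in_part: "gamma \<beta> i \<in> A_SFT_part n \<beta> \<mu> (- 1)"
proof -
  have "Beta (step_side k) {trail \<beta> k, trail \<beta> (Suc k)} \<in> gens n \<beta>" for k
    using Beta_trail(1)[of k] by (auto simp: gens_def)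
  from var_in_part[OF this, of _ \<mu>] show ?thesis
    unfolding gamma_def by (intro part_sum) (simp del: trail.simps)
qed

text \<open>Transposing the \<open>R\<close> block gives both kinds of \<alpha> the same degree
  formula; on the diagonal it reduces to -1, the degree of the \<beta>'s in
  \<open>gamma\<close>.\<close>

lemma Ymat_in_part:
  assumes "i \<in> {1..n}" "j \<in> {1..n}"
  shows "Ymat \<beta> i j \<in> A_SFT_part n \<beta> \<mu> (\<mu> i - \<mu> j - 1)"
proof -
  have gens: "Alpha x a b \<in> gens n \<beta>" if "1 \<le> a" "a < b" "b \<le> n" for x a b
    using that by (auto simp: gens_def)
  consider "i < j" | "j < i" | "i = j" by linarith
  then show ?thesis
  proof cases
    case 1
    then show ?thesis
      using var_in_part[OF gens[of i j L], of \<mu>] assms by (simp add: Ymat_def)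
  next
    case 2
    then show ?thesis
      using var_in_part[OF gens[of j i R], of \<mu>] assms by (simp add: Ymat_def)
  next
    case 3
    then show ?thesis
      using gamma_in_part[of i \<mu>] by (simp add: Ymat_def)
  qed
qed

lemma Ysq_in_part:
  assumes "i \<in> {1..n}" "j \<in> {1..n}"
  shows "Ysq n \<beta> i j \<in> A_SFT_part n \<beta> \<mu> (\<mu> i - \<mu> j - 2)"
  unfolding Ysq_def
proof (rule part_sum)
  fix k assume "k \<in> {1..n}"
  then show "Ymat \<beta> i k * Ymat \<beta> k j \<in> A_SFT_part n \<beta> \<mu> (\<mu> i - \<mu> j - 2)"
    using part_mult[OF Ymat_in_part[of i k \<mu>] Ymat_in_part[of k j \<mu>]] assms by (simp add: algebra_simps)
qed

lemma Ediag_in_part: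
  assumes "p \<in> {1..n}"
  shows "Ediag n \<beta> p \<in> A_SFT_part n \<beta> \<mu> (- 2)"
  using part_add[OF Ysq_in_part[OF assms assms, of \<mu>], of "(gamma \<beta> p)\<^sup>2"]
    part_mult[OF gamma_in_part[of p \<mu>] gamma_in_part[of p \<mu>]]
  by (simp add: Ediag_def power2_eq_square)

text \<open>The degree is written with \<open>+ - 1\<close> to match the shift \<open>e\<close> in
  \<open>deriv_ext_in_part\<close>.\<close>

lemma d_SFT_var_in_part:
  assumes "g \<in> gens n \<beta>"
  shows "d_SFT n \<beta> (var g) \<in> A_SFT_part n \<beta> \<mu> (gen_deg \<mu> g + - 1)"
  using assms
proof (cases rule: gens_cases)
  case (Alpha_L i j)
  then show ?thesis using Ysq_in_part[of i j \<mu>] by (simp add: d_SFT_Alpha_L)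
next
  case (Alpha_R i j)
  then show ?thesis using Ysq_in_part[of j i \<mu>] by (simp add: d_SFT_Alpha_R)
next
  case (Beta x p q)
  have "(var g)\<^sup>2 \<in> A_SFT_part n \<beta> \<mu> (- 2)"
    using part_mult[OF var_in_part[OF assms, of \<mu>] var_in_part[OF assms, of \<mu>]] Beta(1)
    by (simp add: power2_eq_square)
  then show ?thesis
    using Beta Ediag_in_part[of _ \<mu>] by (simp add: d_SFT_Beta part_add)
qed

lemma dga2_A_SFT: "dga2 (A_SFT n \<beta>) (A_SFT_part n \<beta> \<mu>) (d_SFT n \<beta>)"
proof -
  have gen: "d_SFT n \<beta> (var g) \<in> A_SFT n \<beta>" if "g \<in> gens n \<beta>" for g
    using d_SFT_var_in_part[OF that] part_subset by blast
  have "d_SFT n \<beta> p \<in> A_SFT n \<beta>" if "p \<in> A_SFT n \<beta>" for p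
    using deriv_ext_in_polys[OF that[unfolded A_SFT_def], of "\<lambda>g. d_SFT n \<beta> (var g)"] gen
    by (simp add: A_SFT_def flip: d_SFT_deriv_ext)
  moreover have "d_SFT n \<beta> p \<in> A_SFT_part n \<beta> \<mu> (k - 1)" if "p \<in> A_SFT_part n \<beta> \<mu> k" for p k
    using deriv_ext_in_part[OF that, of "\<lambda>g. d_SFT n \<beta> (var g)" "- 1"] d_SFT_var_in_part
    by (simp flip: d_SFT_deriv_ext)
  moreover have "d_SFT n \<beta> (d_SFT n \<beta> p) = 0" if "p \<in> A_SFT n \<beta>" for p
    using d_SFT_squared_zero[OF that[unfolded A_SFT_def]] d_SFT_d_SFT_var by blast
  ultimately show ?thesis
    using subalgebra2_A_SFT graded_by_A_SFT by (simp add: dga2_def d_SFT_add d_SFT_mult)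
qed

end

theorem theorem5p13:
  fixes n :: nat and \<beta> :: "side \<Rightarrow> nat set set" and \<mu> :: "nat \<Rightarrow> int"
  assumes "n \<ge> 1"
    and "pairing n (\<beta> L)" and "pairing n (\<beta> R)"
    and "{trail \<beta> k | k. True} = {1..n}"
  shows "dga2 (A_SFT n \<beta>) (A_SFT_part n \<beta> \<mu>) (d_SFT n \<beta>)
    \<and> (\<forall>p \<in> A_SFT n \<beta>. d_SFT n \<beta> (d_SFT n \<beta> p) = 0)"
proof -
  interpret pairings n \<beta>
  proof
    show "pairing n (\<beta> x)" for x
      using assms(2,3) by (cases x) simp_all
  qed (use assms(4) in \<open>auto simp: full_SetCompr_eq\<close>)
  show ?thesis
    using dga2_A_SFT by (simp add: dga2_def)
qed

end
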